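(* Let $f:T\to X$ be $|RL|$ $m$-integrable on $T$, and let $I_f:\mathcal{A}\to X$ be defined by $I_f(A)=(|RL|)\int_A f\,dm$ for $A\in\mathcal{A}$. Then: (i) If $f$ is bounded and $\overline{m}(T)<+\infty$, then (i.a) $I_f\ll\overline{m}$ in the $\varepsilon$-$\delta$ sense, i.e. for every $\varepsilon>0$ there is $\delta>0$ such that $\|I_f(A)\|<\varepsilon$ for every $A\in\mathcal{A}$ with $\overline{m}(A)<\delta$; moreover $I_f$ is of finite variation, i.e. $\overline{I_f}(T)<+\infty$; (i.b) if moreover $\overline{m}$ is order-continuous (respectively exhaustive) on $\mathcal{A}$, then $I_f$ is also order-continuous (respectively exhaustive). (ii) If $X=\mathbb{R}$, $f:T\to[0,\infty)$ and $m$ is monotone, then $I_f$ is scalar-valued and monotone.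
   Context: $T$ is a nonempty, at least countable (i.e. infinite) set, $\mathcal{A}$ is a $\sigma$-algebra of subsets of $T$, $X$ is a real Banach space with norm $\|\cdot\|$, and $m:\mathcal{A}\to[0,+\infty)$ is an arbitrary set function with $m(\emptyset)=0$ (no additivity is assumed). A countable partition of $A\in\mathcal{A}$ is an at most countable family $\{A_n\}$ of pairwise disjoint nonempty sets of $\mathcal{A}$ with union $A$ (the empty family if $A=\emptyset$). For partitions $P,P'$ of $A$, write $P'\ge P$ if every set of $P'$ is included in some set of $P$. For $A\in\mathcal{A}$, a function $f:T\to X$ is $|RL|$ (absolutely Riemann-Lebesgue) $m$-integrable on $A$ if there is $b\in X$ such that for every $\varepsilon>0$ there is a countable partition $P_\varepsilon$ of $A$ such that for every countable partition $P=\{A_n\}$ of $A$ with $P\ge P_\varepsilon$: $f$ is bounded on every $A_n$ with $m(A_n)>0$, and for every choice of points $t_n\in A_n$ the series $\sum_n f(t_n)m(A_n)$ is absolutely convergent and $\|\sum_n f(t_n)m(A_n)-b\|<\varepsilon$. The vector $b$ is unique and is denoted $(|RL|)\int_A f\,dm$. If $f$ is $|RL|$ $m$-integrable on $T$, it is $|RL|$ $m$-integrable on every $A\in\mathcal{A}$, so $I_f$ is well defined. For a set function $\mu:\mathcal{A}\to[0,+\infty)$ or $\mu:\mathcal{A}\to X$ with $\mu(\emptyset)=0$, its variation is $\overline{\mu}(E)=\sup\{\sum_{i=1}^n\|\mu(A_i)\|\}$ for $E\subseteq T$, the supremum being over all finite families of pairwise disjoint sets $A_1,\dots,A_n\in\mathcal{A}$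 with $A_i\subseteq E$ (absolute value in place of the norm for scalar $\mu$). A set function $\mu$ on $\mathcal{A}$ is order-continuous if $\mu(A_n)\to0$ for every decreasing sequence $(A_n)\subset\mathcal{A}$ with $\bigcap_n A_n=\emptyset$; exhaustive if $\mu(A_n)\to0$ for every sequence $(A_n)\subset\mathcal{A}$ of pairwise disjoint sets; a real-valued $\mu$ is monotone if $\mu(A)\le\mu(B)$ whenever $A\subseteq B$, $A,B\in\mathcal{A}$. *)

theory Defs
  imports "HOL-Analysis.Analysis"
begin

definition countable_partition :: "'a set set \<Rightarrow> 'a set \<Rightarrow> 'a set set \<Rightarrow> bool" where
  "countable_partition \<A> A P \<longleftrightarrow> countable P \<and> P \<subseteq> \<A> \<and> partition_on A P"

definition finer :: "'a set set \<Rightarrow> 'a set set \<Rightarrow> bool" where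
  "finer P' P \<longleftrightarrow> (\<forall>B\<in>P'. \<exists>C\<in>P. B \<subseteq> C)"

text \<open>
  A partition is a set of sets, so a choice of points is a function \<open>t\<close> on its members, and
  the series is a sum over the countable index set \<open>P\<close>. As it is required to converge
  absolutely, its value does not depend on an enumeration of \<open>P\<close>.
\<close>

definition has_RL_integral ::
  "'a set set \<Rightarrow> ('a set \<Rightarrow> real) \<Rightarrow> ('a \<Rightarrow> 'b::banach) \<Rightarrow> 'a set \<Rightarrow> 'b \<Rightarrow> bool" where
  "has_RL_integral \<A> m f A b \<longleftrightarrow>
     (\<forall>\<epsilon>>0. \<exists>P\<^sub>0. countable_partition \<A> A P\<^sub>0 \<and>
        (\<forall>P. countable_partition \<A> A P \<and> finer P P\<^sub>0 \<longrightarrow>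
           (\<forall>B\<in>P. m B > 0 \<longrightarrow> bounded (f ` B)) \<and>
           (\<forall>t. (\<forall>B\<in>P. t B \<in> B) \<longrightarrow>
              (\<lambda>B. norm (m B *\<^sub>R f (t B))) summable_on P \<and>
              norm ((\<Sum>\<^sub>\<infinity>B\<in>P. m B *\<^sub>R f (t B)) - b) < \<epsilon>)))"

definition RL_integrable ::
  "'a set set \<Rightarrow> ('a set \<Rightarrow> real) \<Rightarrow> ('a \<Rightarrow> 'b::banach) \<Rightarrow> 'a set \<Rightarrow> bool" where
  "RL_integrable \<A> m f A \<longleftrightarrow> (\<exists>b. has_RL_integral \<A> m f A b)"

definition RL_integral ::
  "'a set set \<Rightarrow> ('a set \<Rightarrow> real) \<Rightarrow> ('a \<Rightarrow> 'b::banach) \<Rightarrow> 'a set \<Rightarrow> 'b" where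
  "RL_integral \<A> m f A = (THE b. has_RL_integral \<A> m f A b)"

text \<open>For real-valued \<open>\<mu>\<close> the norm below is the absolute value.\<close>

definition variation ::
  "'a set set \<Rightarrow> ('a set \<Rightarrow> 'b::real_normed_vector) \<Rightarrow> 'a set \<Rightarrow> ennreal" where
  "variation \<A> \<mu> E =
     Sup {(\<Sum>i<n. ennreal (norm (\<mu> (B i)))) | (n::nat) B.
            (\<forall>i<n. B i \<in> \<A> \<and> B i \<subseteq> E) \<and> disjoint_family_on B {..<n}}"

text \<open>
  The codomain is left general so that the next two notions apply both to vector-valued set
  functions and to the \<open>[0,\<infinity>]\<close>-valued variation.
\<close>

definition order_continuous ::
  "'a set set \<Rightarrow> ('a set \<Rightarrow> 'c::{topological_space,zero}) \<Rightarrow> bool" where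
  "order_continuous \<A> \<mu> \<longleftrightarrow>
     (\<forall>A. range A \<subseteq> \<A> \<and> decseq A \<and> (\<Inter>n. A n) = {} \<longrightarrow> (\<lambda>n. \<mu> (A n)) \<longlonglongrightarrow> 0)"

definition exhaustive ::
  "'a set set \<Rightarrow> ('a set \<Rightarrow> 'c::{topological_space,zero}) \<Rightarrow> bool" where
  "exhaustive \<A> \<mu> \<longleftrightarrow>
     (\<forall>A. range A \<subseteq> \<A> \<and> disjoint_family A \<longrightarrow> (\<lambda>n. \<mu> (A n)) \<longlonglongrightarrow> 0)"

end

theory Submission
  imports Defs
begin

text \<open>
  Everything rests on two facts. First, an integrable function on \<open>T\<close> is integrable on each
  member \<open>A\<close> of the \<open>\<sigma>\<close>-algebra: a fine partition of \<open>A\<close> extends to a fine partition of \<open>T\<close> by one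
  fixed partition of \<open>T - A\<close>, so two Riemann-Lebesgue sums over \<open>A\<close> differ by as much as two sums
  over \<open>T\<close>, and the sums over \<open>A\<close> are Cauchy
  (\<open>has_RL_integral_subset_Cauchy\<close>, \<open>RL_integrable_subset\<close>). Because common refinements exist, the
  integral is unique, so \<open>RL_integral\<close> really is the limit of these sums.

  Secondly, if \<open>\<parallel>f\<parallel> \<le> M\<close>, then every sum over a partition of \<open>A\<close> has norm at most
  \<open>M * \<Sum> m B\<close>, hence at most \<open>M\<close> times the variation of \<open>m\<close> on \<open>A\<close>, and the integral inherits
  this bound (\<open>norm_RL_integral_le_variation\<close>). This gives absolute continuity, and order continuity
  and exhaustivity follow from that. Since the variation is superadditive on disjoint sets, adding
  the bound up over a disjoint family shows that the variation of the integral on \<open>T\<close> is at most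
  \<open>M\<close> times that of \<open>m\<close>.

  For monotonicity, a fine partition of \<open>A\<close> is part of a fine partition of a larger set \<open>B\<close>;
  the additional summands are nonnegative, so each sum over \<open>A\<close> is bounded by a sum over \<open>B\<close>.
\<close>

section \<open>Countable partitions\<close>

text \<open>Removing \<open>{}\<close> matters for \<open>A = {}\<close>, whose only partition is the empty family.\<close>

lemma countable_partition_trivial:
  assumes "A \<in> \<A>"
  shows "countable_partition \<A> A ({A} - {{}})"
  using assms by (auto simp: countable_partition_def partition_on_def disjoint_def)

lemma finer_trans: "finer P Q \<Longrightarrow> finer Q R \<Longrightarrow> finer P R"
  unfolding finer_def by (meson subset_trans)

lemma finer_refl: "finer P P"
  unfolding finer_def by blast

lemma common_refinement:
  assumes "sigma_algebra T \<A>" "countable_partition \<A> B P" "countable_partition \<A> A Q" "A \<subseteq> B"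
  obtains R where "countable_partition \<A> A R" "finer R P" "finer R Q"
proof
  define R where "R = (\<lambda>(C, D). C \<inter> D) ` (P \<times> Q) - {{}}"
  interpret sigma_algebra T \<A> by fact
  have dP: "C = C'" if "x \<in> C" "x \<in> C'" "C \<in> P" "C' \<in> P" for x C C'
    using that assms(2) unfolding countable_partition_def partition_on_def disjoint_def by blast
  have dQ: "C = C'" if "x \<in> C" "x \<in> C'" "C \<in> Q" "C' \<in> Q" for x C C'
    using that assms(3) unfolding countable_partition_def partition_on_def disjoint_def by blast
  have sub: "P \<subseteq> \<A>" "Q \<subseteq> \<A>" "countable P" "countable Q" "\<Union>P = B" "\<Union>Q = A"
    using assms(2,3) by (auto simp: countable_partition_def partition_on_def)
  have "partition_on A R"
  proof (rule partition_onI)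
    show "\<Union>R = A"
    proof
      show "\<Union>R \<subseteq> A" using sub(6) unfolding R_def by blast
      show "A \<subseteq> \<Union>R"
      proof
        fix x assume "x \<in> A"
        then obtain C D where "C \<in> P" "x \<in> C" "D \<in> Q" "x \<in> D"
          using sub(5,6) assms(4) by blast
        then show "x \<in> \<Union>R" unfolding R_def by blast
      qed
    qed
  next
    fix p q assume pq: "p \<in> R" "q \<in> R" "p \<noteq> q"
    obtain C D where p: "p = C \<inter> D" "C \<in> P" "D \<in> Q" using pq(1) unfolding R_def by auto
    obtain C' D' where q: "q = C' \<inter> D'" "C' \<in> P" "D' \<in> Q" using pq(2) unfolding R_def by auto
    have False if "x \<in> p" "x \<in> q" for x
      using dP[of x C C'] dQ[of x D D'] that p q pq(3) by auto
    then show "disjnt p q" by (auto simp: disjnt_def)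
  qed (simp add: R_def)
  moreover have "R \<subseteq> \<A>" using sub unfolding R_def by auto
  moreover have "countable R" using sub unfolding R_def by auto
  ultimately show "countable_partition \<A> A R" by (simp add: countable_partition_def)
  show "finer R P" "finer R Q" unfolding finer_def R_def by auto
qed

lemma countable_partition_Un:
  assumes "countable_partition \<A> A P" "countable_partition \<A> B Q" "A \<inter> B = {}"
  shows "countable_partition \<A> (A \<union> B) (P \<union> Q)" "P \<inter> Q = {}"
proof -
  have *: "\<Union>P = A" "\<Union>Q = B" "{} \<notin> P" "{} \<notin> Q" "disjoint P" "disjoint Q"
    using assms(1,2) by (auto simp: countable_partition_def partition_on_def)
  have cross: "C \<inter> D = {}" if "C \<in> P" "D \<in> Q" for C D
    using that * assms(3) by blast
  then show "P \<inter> Q = {}" using *(3) by fastforce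
  have "disjoint (P \<union> Q)"
    using *(5,6) cross unfolding disjoint_def by blast
  then show "countable_partition \<A> (A \<union> B) (P \<union> Q)"
    using assms(1,2) * by (auto simp: countable_partition_def partition_on_def)
qed

text \<open>
  The partition \<open>Q\<close> of the remainder is chosen before \<open>P\<close>. That is what allows sums over two
  different partitions of \<open>A\<close> to be completed by the same terms.
\<close>

lemma partition_extension:
  assumes "sigma_algebra T \<A>" "countable_partition \<A> B P\<^sub>0" "A \<in> \<A>" "B \<in> \<A>" "A \<subseteq> B"
  obtains Q where "countable_partition \<A> (B - A) Q"
    "\<And>P. countable_partition \<A> A P \<Longrightarrow> finer P P\<^sub>0 \<Longrightarrow>
       countable_partition \<A> B (P \<union> Q) \<and> finer (P \<union> Q) P\<^sub>0 \<and> P \<inter> Q = {}"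
proof -
  interpret sigma_algebra T \<A> by fact
  have "B - A \<in> \<A>" using assms(3,4) by auto
  then obtain Q where Q: "countable_partition \<A> (B - A) Q" "finer Q P\<^sub>0"
    using common_refinement[OF assms(1,2) countable_partition_trivial[of "B - A" \<A>]] by blast
  have "countable_partition \<A> B (P \<union> Q) \<and> finer (P \<union> Q) P\<^sub>0 \<and> P \<inter> Q = {}"
    if P: "countable_partition \<A> A P" "finer P P\<^sub>0" for P
  proof -
    have "A \<union> (B - A) = B" using assms(5) by blast
    moreover have "finer (P \<union> Q) P\<^sub>0" using P(2) Q(2) unfolding finer_def by blast
    ultimately show ?thesis using countable_partition_Un[OF P(1) Q(1)] by auto
  qed
  with Q(1) show thesis by (rule that)
qed

section \<open>Riemann-Lebesgue sums\<close>

definition tags :: "('a set \<Rightarrow> 'a) \<Rightarrow> 'a set set \<Rightarrow> bool" where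
  "tags t P \<longleftrightarrow> (\<forall>B\<in>P. t B \<in> B)"

definition RL_sum :: "('a set \<Rightarrow> real) \<Rightarrow> ('a \<Rightarrow> 'b::banach) \<Rightarrow> 'a set set \<Rightarrow> ('a set \<Rightarrow> 'a) \<Rightarrow> 'b" where
  "RL_sum m f P t = (\<Sum>\<^sub>\<infinity>B\<in>P. m B *\<^sub>R f (t B))"

definition RL_admissible ::
  "('a set \<Rightarrow> real) \<Rightarrow> ('a \<Rightarrow> 'b::banach) \<Rightarrow> 'a set set \<Rightarrow> bool" where
  "RL_admissible m f P \<longleftrightarrow>
     (\<forall>B\<in>P. m B > 0 \<longrightarrow> bounded (f ` B)) \<and>
     (\<forall>t. tags t P \<longrightarrow> (\<lambda>B. norm (m B *\<^sub>R f (t B))) summable_on P)"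

lemma tags_exist:
  assumes "countable_partition \<A> A P"
  obtains t where "tags t P"
proof
  have "{} \<notin> P" using assms by (simp add: countable_partition_def partition_on_def)
  then show "tags (\<lambda>B. SOME x. x \<in> B) P"
    unfolding tags_def using some_in_eq by fastforce
qed

text \<open>
  Separating the qualitative condition on the partition from the estimate makes it possible to pass
  the former to parts of a partition, while only the estimate involves the integral.
\<close>

lemma has_RL_integral_iff:
  "has_RL_integral \<A> m f A b \<longleftrightarrow>
     (\<forall>\<epsilon>>0. \<exists>P\<^sub>0. countable_partition \<A> A P\<^sub>0 \<and>
        (\<forall>P. countable_partition \<A> A P \<and> finer P P\<^sub>0 \<longrightarrow>
           RL_admissible m f P \<and> (\<forall>t. tags t P \<longrightarrow> norm (RL_sum m f P t - b) < \<epsilon>)))"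
  unfolding has_RL_integral_def RL_admissible_def RL_sum_def tags_def
  by (simp add: all_conj_distrib imp_conjR)

text \<open>
  Summability over \<open>P\<close> is required only for tags, so tags of \<open>P\<close> must first be extended to \<open>P \<union> Q\<close>;
  \<open>Q\<close> has to be a partition because its members must be nonempty.
\<close>

lemma RL_admissible_mono:
  assumes "RL_admissible m f (P \<union> Q)" "countable_partition \<A> B Q"
  shows "RL_admissible m f P"
  unfolding RL_admissible_def
proof (intro conjI allI impI)
  show "\<forall>B\<in>P. 0 < m B \<longrightarrow> bounded (f ` B)"
    using assms(1) unfolding RL_admissible_def by blast
next
  fix t assume t: "tags t P"
  obtain s where s: "tags s Q" using tags_exist[OF assms(2)] .
  let ?u = "\<lambda>B. if B \<in> P then t B else s B"
  have "tags ?u (P \<union> Q)" using s t by (auto simp: tags_def)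
  then have "(\<lambda>B. norm (m B *\<^sub>R f (?u B))) summable_on P \<union> Q"
    using assms(1) unfolding RL_admissible_def by blast
  then have "(\<lambda>B. norm (m B *\<^sub>R f (?u B))) summable_on P"
    by (rule summable_on_subset_banach) simp
  then show "(\<lambda>B. norm (m B *\<^sub>R f (t B))) summable_on P"
    by (rule summable_on_cong[THEN iffD1, rotated]) simp
qed

lemma RL_sum_Un:
  assumes "RL_admissible m f P" "RL_admissible m f Q" "P \<inter> Q = {}" "tags t P" "tags s Q"
  defines "u \<equiv> \<lambda>B. if B \<in> P then t B else s B"
  shows "tags u (P \<union> Q)" "RL_sum m f (P \<union> Q) u = RL_sum m f P t + RL_sum m f Q s"
proof -
  show "tags u (P \<union> Q)" using assms(4,5) by (auto simp: tags_def u_def)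
  have eqP: "u B = t B" if "B \<in> P" for B using that by (simp add: u_def)
  have eqQ: "u B = s B" if "B \<in> Q" for B using that assms(3) by (auto simp: u_def)
  have "tags u P" "tags u Q"
    using assms(4,5) eqP eqQ by (auto simp: tags_def)
  then have "(\<lambda>B. m B *\<^sub>R f (u B)) summable_on P" "(\<lambda>B. m B *\<^sub>R f (u B)) summable_on Q"
    using assms(1,2) by (auto simp: RL_admissible_def intro: abs_summable_summable)
  then have "RL_sum m f (P \<union> Q) u = RL_sum m f P u + RL_sum m f Q u"
    unfolding RL_sum_def using assms(3) by (rule infsum_Un_disjoint)
  moreover have "RL_sum m f P u = RL_sum m f P t" "RL_sum m f Q u = RL_sum m f Q s"
    unfolding RL_sum_def using eqP eqQ by (auto intro: infsum_cong)
  ultimately show "RL_sum m f (P \<union> Q) u = RL_sum m f P t + RL_sum m f Q s" by simp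
qed

lemma has_RL_integral_approx:
  assumes "sigma_algebra T \<A>" "has_RL_integral \<A> m f A b" "\<epsilon> > 0"
  obtains P t where "countable_partition \<A> A P" "RL_admissible m f P" "tags t P"
    "norm (RL_sum m f P t - b) < \<epsilon>"
proof -
  obtain P where P: "countable_partition \<A> A P" "RL_admissible m f P"
    "\<And>t. tags t P \<Longrightarrow> norm (RL_sum m f P t - b) < \<epsilon>"
    using assms(2,3) finer_refl unfolding has_RL_integral_iff by meson
  obtain t where "tags t P" using tags_exist[OF P(1)] .
  with P show thesis using that by blast
qed

lemma has_RL_integral_unique:
  assumes "sigma_algebra T \<A>" "has_RL_integral \<A> m f A b" "has_RL_integral \<A> m f A c"
  shows "b = c"
proof (rule ccontr)
  assume "b \<noteq> c"
  define \<epsilon> where "\<epsilon> = norm (b - c) / 2"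
  have pos: "\<epsilon> > 0" using \<open>b \<noteq> c\<close> by (simp add: \<epsilon>_def)
  obtain P where P: "countable_partition \<A> A P"
    "\<And>R t. countable_partition \<A> A R \<Longrightarrow> finer R P \<Longrightarrow> tags t R \<Longrightarrow> norm (RL_sum m f R t - b) < \<epsilon>"
    using assms(2) pos unfolding has_RL_integral_iff by meson
  obtain Q where Q: "countable_partition \<A> A Q"
    "\<And>R t. countable_partition \<A> A R \<Longrightarrow> finer R Q \<Longrightarrow> tags t R \<Longrightarrow> norm (RL_sum m f R t - c) < \<epsilon>"
    using assms(3) pos unfolding has_RL_integral_iff by meson
  obtain R where R: "countable_partition \<A> A R" "finer R P" "finer R Q"
    using common_refinement[OF assms(1) P(1) Q(1)] by blast
  obtain t where t: "tags t R" using tags_exist[OF R(1)] .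
  have "norm (b - c) < 2 * \<epsilon>"
    using P(2)[OF R(1,2) t] Q(2)[OF R(1,3) t]
      norm_triangle_ineq4[of "RL_sum m f R t - c" "RL_sum m f R t - b"] by simp
  then show False by (simp add: \<epsilon>_def)
qed

lemma has_RL_integral_RL_integral:
  assumes "sigma_algebra T \<A>" "RL_integrable \<A> m f A"
  shows "has_RL_integral \<A> m f A (RL_integral \<A> m f A)"
  using assms has_RL_integral_unique unfolding RL_integrable_def RL_integral_def
  by (metis theI)

section \<open>Integrability on subsets\<close>

text \<open>
  Completing two sums over \<open>A\<close> by the same tagged partition of \<open>B - A\<close> gives two sums over \<open>B\<close> with
  the same difference, and these are both close to the integral over \<open>B\<close>.
\<close>

lemma has_RL_integral_subset_Cauchy:
  fixes f :: "'a \<Rightarrow> 'b::banach"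
  assumes "sigma_algebra T \<A>" "has_RL_integral \<A> m f B b" "A \<in> \<A>" "B \<in> \<A>" "A \<subseteq> B" "\<epsilon> > 0"
  obtains P\<^sub>0 where "countable_partition \<A> A P\<^sub>0"
    "\<And>P. countable_partition \<A> A P \<Longrightarrow> finer P P\<^sub>0 \<Longrightarrow> RL_admissible m f P"
    "\<And>P P' t t'. countable_partition \<A> A P \<Longrightarrow> finer P P\<^sub>0 \<Longrightarrow> tags t P \<Longrightarrow>
       countable_partition \<A> A P' \<Longrightarrow> finer P' P\<^sub>0 \<Longrightarrow> tags t' P' \<Longrightarrow>
       norm (RL_sum m f P t - RL_sum m f P' t') < \<epsilon>"
proof -
  obtain Pb where Pb: "countable_partition \<A> B Pb"
    "\<And>R. countable_partition \<A> B R \<Longrightarrow> finer R Pb \<Longrightarrow> RL_admissible m f R"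
    "\<And>R t. countable_partition \<A> B R \<Longrightarrow> finer R Pb \<Longrightarrow> tags t R \<Longrightarrow> norm (RL_sum m f R t - b) < \<epsilon> / 2"
    using assms(2) half_gt_zero[OF assms(6)] unfolding has_RL_integral_iff by meson
  obtain Q where Q: "countable_partition \<A> (B - A) Q"
    "\<And>P. countable_partition \<A> A P \<Longrightarrow> finer P Pb \<Longrightarrow>
       countable_partition \<A> B (P \<union> Q) \<and> finer (P \<union> Q) Pb \<and> P \<inter> Q = {}"
    using partition_extension[OF assms(1) Pb(1) assms(3-5)] by blast
  obtain s where s: "tags s Q" using tags_exist[OF Q(1)] .
  obtain P\<^sub>0 where P0: "countable_partition \<A> A P\<^sub>0" "finer P\<^sub>0 Pb"
    using common_refinement[OF assms(1) Pb(1) countable_partition_trivial[OF assms(3)] assms(5)]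
    by blast
  have adm: "RL_admissible m f P \<and> RL_admissible m f Q"
    if P: "countable_partition \<A> A P" "finer P Pb" for P
  proof -
    have "RL_admissible m f (P \<union> Q)" using Pb(2) Q(2)[OF P] by blast
    then show ?thesis
      using RL_admissible_mono[OF _ Q(1)] RL_admissible_mono[OF _ P(1)] by (metis Un_commute)
  qed
  have near: "norm (RL_sum m f P t + RL_sum m f Q s - b) < \<epsilon> / 2"
    if P: "countable_partition \<A> A P" "finer P Pb" "tags t P" for P t
    using RL_sum_Un[of m f P Q t s] adm[OF P(1,2)] Q(2)[OF P(1,2)] P(3) s Pb(3) by metis
  show thesis
  proof
    show "countable_partition \<A> A P\<^sub>0" by fact
    show "RL_admissible m f P" if "countable_partition \<A> A P" "finer P P\<^sub>0" for P
      using adm that finer_trans P0(2) by blast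
    fix P P' t t'
    assume *: "countable_partition \<A> A P" "finer P P\<^sub>0" "tags t P"
      "countable_partition \<A> A P'" "finer P' P\<^sub>0" "tags t' P'"
    have "norm (RL_sum m f P t + RL_sum m f Q s - b) < \<epsilon> / 2"
      "norm (RL_sum m f P' t' + RL_sum m f Q s - b) < \<epsilon> / 2"
      using near * finer_trans P0(2) by blast+
    then show "norm (RL_sum m f P t - RL_sum m f P' t') < \<epsilon>"
      using norm_triangle_ineq4[of "RL_sum m f P t + RL_sum m f Q s - b"
          "RL_sum m f P' t' + RL_sum m f Q s - b"] by simp
  qed
qed

text \<open>
  The limit is found along one arbitrary tagged partition per tolerance \<open>1 / (n + 1)\<close>. These need not
  refine one another: any two of them are compared through a common refinement.
\<close>

lemma RL_integrable_subset:
  fixes f :: "'a \<Rightarrow> 'b::banach"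
  assumes sa: "sigma_algebra T \<A>" and "RL_integrable \<A> m f B" "A \<in> \<A>" "B \<in> \<A>" "A \<subseteq> B"
  shows "RL_integrable \<A> m f A"
proof -
  obtain b where b: "has_RL_integral \<A> m f B b" using assms(2) by (auto simp: RL_integrable_def)
  define r where "r n = 1 / real (Suc n)" for n
  have r_pos: "r n > 0" for n by (simp add: r_def)
  have r_lim: "r \<longlonglongrightarrow> 0" unfolding r_def using LIMSEQ_inverse_real_of_nat by (simp add: inverse_eq_divide)
  have "\<exists>P\<^sub>0. countable_partition \<A> A P\<^sub>0 \<and>
      (\<forall>P. countable_partition \<A> A P \<and> finer P P\<^sub>0 \<longrightarrow> RL_admissible m f P) \<and>
      (\<forall>P P' t t'. countable_partition \<A> A P \<and> finer P P\<^sub>0 \<and> tags t P \<and>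
         countable_partition \<A> A P' \<and> finer P' P\<^sub>0 \<and> tags t' P' \<longrightarrow>
         norm (RL_sum m f P t - RL_sum m f P' t') < r n)" for n
    by (rule has_RL_integral_subset_Cauchy[OF sa b assms(3-5) r_pos[of n]]) blast
  then obtain P where P: "\<And>n. countable_partition \<A> A (P n)"
    and adm: "\<And>n R. countable_partition \<A> A R \<Longrightarrow> finer R (P n) \<Longrightarrow> RL_admissible m f R"
    and close: "\<And>n R R' t t'. countable_partition \<A> A R \<Longrightarrow> finer R (P n) \<Longrightarrow> tags t R \<Longrightarrow>
         countable_partition \<A> A R' \<Longrightarrow> finer R' (P n) \<Longrightarrow> tags t' R' \<Longrightarrow>
         norm (RL_sum m f R t - RL_sum m f R' t') < r n"
    by metis
  have "\<exists>t. tags t (P n)" for n using tags_exist[OF P] by metis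
  then obtain t where t: "\<And>n. tags (t n) (P n)" by metis
  define c where "c n = RL_sum m f (P n) (t n)" for n
  have c: "norm (c k - c n) < r k + r n" for k n
  proof -
    obtain R where R: "countable_partition \<A> A R" "finer R (P k)" "finer R (P n)"
      using common_refinement[OF sa P P] by blast
    obtain s where s: "tags s R" using tags_exist[OF R(1)] .
    have "norm (c k - RL_sum m f R s) < r k"
      unfolding c_def using close[OF P finer_refl t R(1,2) s] .
    moreover have "norm (RL_sum m f R s - c n) < r n"
      unfolding c_def using close[OF R(1,3) s P finer_refl t] .
    ultimately show ?thesis
      using norm_triangle_ineq[of "c k - RL_sum m f R s" "RL_sum m f R s - c n"] by simp
  qed
  have small: "\<exists>N. \<forall>n\<ge>N. r n < \<epsilon>" if "\<epsilon> > 0" for \<epsilon>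
    using order_tendstoD(2)[OF r_lim that] by (simp add: eventually_sequentially)
  have "Cauchy c"
  proof (rule CauchyI)
    fix \<epsilon> :: real assume "\<epsilon> > 0"
    then obtain N where N: "\<And>n. n \<ge> N \<Longrightarrow> r n < \<epsilon> / 2" using small[of "\<epsilon> / 2"] by auto
    show "\<exists>M. \<forall>k\<ge>M. \<forall>n\<ge>M. norm (c k - c n) < \<epsilon>"
    proof (intro exI allI impI)
      fix k n assume "k \<ge> N" "n \<ge> N"
      then show "norm (c k - c n) < \<epsilon>" using c[of k n] N[of k] N[of n] by linarith
    qed
  qed
  then obtain a where a: "c \<longlonglongrightarrow> a" by (auto simp: Cauchy_convergent_iff convergent_def)
  have ca: "norm (c n - a) \<le> r n" for n
  proof (rule LIMSEQ_le)
    show "(\<lambda>k. norm (c n - c k)) \<longlonglongrightarrow> norm (c n - a)" by (intro tendsto_intros a)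
    show "(\<lambda>k. r n + r k) \<longlonglongrightarrow> r n" using tendsto_add[OF tendsto_const r_lim] by simp
    show "\<exists>N. \<forall>k\<ge>N. norm (c n - c k) \<le> r n + r k" using c less_imp_le by blast
  qed
  have "has_RL_integral \<A> m f A a"
    unfolding has_RL_integral_iff
  proof (intro allI impI)
    fix \<epsilon> :: real assume "\<epsilon> > 0"
    then obtain n where n: "r n < \<epsilon> / 2" using small[of "\<epsilon> / 2"] by auto
    have "RL_admissible m f R \<and> (\<forall>s. tags s R \<longrightarrow> norm (RL_sum m f R s - a) < \<epsilon>)"
      if R: "countable_partition \<A> A R" "finer R (P n)" for R
    proof (intro conjI allI impI)
      show "RL_admissible m f R" using adm R .
      fix s assume s: "tags s R"
      have "norm (RL_sum m f R s - c n) < r n"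
        unfolding c_def using close[OF R s P finer_refl t] .
      then show "norm (RL_sum m f R s - a) < \<epsilon>"
        using ca[of n] n norm_triangle_ineq[of "RL_sum m f R s - c n" "c n - a"] by simp
    qed
    then show "\<exists>P\<^sub>0. countable_partition \<A> A P\<^sub>0 \<and>
        (\<forall>R. countable_partition \<A> A R \<and> finer R P\<^sub>0 \<longrightarrow>
           RL_admissible m f R \<and> (\<forall>s. tags s R \<longrightarrow> norm (RL_sum m f R s - a) < \<epsilon>))"
      using P by blast
  qed
  then show ?thesis by (auto simp: RL_integrable_def)
qed

section \<open>The variation\<close>

lemma sum_le_variation:
  assumes "finite I" "\<And>i. i \<in> I \<Longrightarrow> B i \<in> \<A>" "\<And>i. i \<in> I \<Longrightarrow> B i \<subseteq> E" "disjoint_family_on B I"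
  shows "(\<Sum>i\<in>I. ennreal (norm (\<mu> (B i)))) \<le> variation \<A> \<mu> E"
proof -
  obtain h where h: "bij_betw h {..<card I} I"
    using ex_bij_betw_nat_finite[OF assms(1)] by (auto simp: atLeast0LessThan)
  have "(\<Sum>i\<in>I. ennreal (norm (\<mu> (B i)))) = (\<Sum>i<card I. ennreal (norm (\<mu> ((B \<circ> h) i))))"
    using sum.reindex_bij_betw[OF h, of "\<lambda>i. ennreal (norm (\<mu> (B i)))"] by simp
  moreover have "(B \<circ> h) i \<in> \<A> \<and> (B \<circ> h) i \<subseteq> E" if "i < card I" for i
    using that assms(2,3) bij_betwE[OF h] by auto
  moreover have "disjoint_family_on (B \<circ> h) {..<card I}"
    using assms(4) bij_betwE[OF h] bij_betw_imp_inj_on[OF h]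
    unfolding disjoint_family_on_def inj_on_def comp_def by blast
  ultimately show ?thesis unfolding variation_def by (intro Sup_upper) blast
qed

lemma variation_least:
  assumes "\<And>(n::nat) B. \<forall>i<n. B i \<in> \<A> \<and> B i \<subseteq> E \<Longrightarrow>
    disjoint_family_on B {..<n} \<Longrightarrow> (\<Sum>i<n. ennreal (norm (\<mu> (B i)))) \<le> v"
  shows "variation \<A> \<mu> E \<le> v"
  unfolding variation_def by (rule Sup_least) (use assms in blast)

text \<open>
  A disjoint family in \<open>E\<close> and one in \<open>F\<close> together form a disjoint family in \<open>E \<union> F\<close>, indexed by the
  disjoint sum of the two index sets; then each supremum is taken separately.
\<close>

lemma variation_superadditive:
  assumes "E \<inter> F = {}"
  shows "variation \<A> \<mu> E + variation \<A> \<mu> F \<le> variation \<A> \<mu> (E \<union> F)"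
proof -
  define S where "S E = {(\<Sum>i<n. ennreal (norm (\<mu> (B i)))) | (n::nat) B.
            (\<forall>i<n. B i \<in> \<A> \<and> B i \<subseteq> E) \<and> disjoint_family_on B {..<n}}" for E
  have var: "variation \<A> \<mu> E = Sup (S E)" for E by (simp add: variation_def S_def)
  have "(\<Sum>i<(0::nat). ennreal (norm (\<mu> {}))) \<in> S E" for E
    unfolding S_def by (rule CollectI, rule exI[of _ 0], rule exI[of _ "\<lambda>_. {}"])
      (simp add: disjoint_family_on_def)
  then have ne: "S E \<noteq> {}" for E by blast
  have "x + y \<le> variation \<A> \<mu> (E \<union> F)" if xy: "x \<in> S E" "y \<in> S F" for x y
  proof -
    obtain n B where B: "x = (\<Sum>i<(n::nat). ennreal (norm (\<mu> (B i))))"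
      "\<And>i. i < n \<Longrightarrow> B i \<in> \<A> \<and> B i \<subseteq> E" "disjoint_family_on B {..<n}"
      using xy(1) unfolding S_def by blast
    obtain k C where C: "y = (\<Sum>i<(k::nat). ennreal (norm (\<mu> (C i))))"
      "\<And>i. i < k \<Longrightarrow> C i \<in> \<A> \<and> C i \<subseteq> F" "disjoint_family_on C {..<k}"
      using xy(2) unfolding S_def by blast
    have cross: "B i \<inter> C j = {}" if "i < n" "j < k" for i j
      using B(2)[OF that(1)] C(2)[OF that(2)] assms by blast
    have "disjoint_family_on (case_sum B C) ({..<n} <+> {..<k})"
      using B(3) C(3) cross unfolding disjoint_family_on_def Plus_def
      by (simp add: ball_Un Int_commute)
    then have "(\<Sum>i\<in>{..<n} <+> {..<k}. ennreal (norm (\<mu> (case_sum B C i)))) \<le> variation \<A> \<mu> (E \<union> F)"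
      using B(2) C(2) by (intro sum_le_variation) (auto, blast+)
    then show ?thesis by (simp add: sum.Plus B(1) C(1) del: sum_ennreal)
  qed
  then have "(SUP y\<in>S F. x + y) \<le> variation \<A> \<mu> (E \<union> F)" if "x \<in> S E" for x
    using that by (intro SUP_least)
  then have "(SUP x\<in>S E. x + Sup (S F)) \<le> variation \<A> \<mu> (E \<union> F)"
    by (intro SUP_least) (simp add: ennreal_SUP_add_right[OF ne, symmetric])
  then show ?thesis
    unfolding var[of E] var[of F] by (simp add: ennreal_SUP_add_left[OF ne])
qed

lemma variation_mono:
  assumes "E \<subseteq> F"
  shows "variation \<A> \<mu> E \<le> variation \<A> \<mu> F"
  using assms by (intro variation_least sum_le_variation) auto

lemma sum_variation_le:
  fixes B :: "nat \<Rightarrow> 'a set"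
  assumes "disjoint_family_on B {..<n}" "\<And>i. i < n \<Longrightarrow> B i \<subseteq> E"
  shows "(\<Sum>i<n. variation \<A> \<mu> (B i)) \<le> variation \<A> \<mu> E"
proof -
  have "(\<Sum>i<n. variation \<A> \<mu> (B i)) \<le> variation \<A> \<mu> (\<Union>i<n. B i)"
    using assms(1)
  proof (induction n)
    case (Suc n)
    have "(\<Union>i<n. B i) \<inter> B n = {}"
    proof -
      have "B i \<inter> B n = {}" if "i < n" for i
        using that by (intro disjoint_family_onD[OF Suc.prems]) auto
      then show ?thesis by blast
    qed
    then have "variation \<A> \<mu> (\<Union>i<n. B i) + variation \<A> \<mu> (B n) \<le> variation \<A> \<mu> (\<Union>i<Suc n. B i)"
      using variation_superadditive[of "\<Union>i<n. B i" "B n" \<A> \<mu>]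
      by (simp add: lessThan_Suc Un_commute[of "B n"])
    moreover have "disjoint_family_on B {..<n}"
      using Suc.prems by (rule disjoint_family_on_mono[rotated]) auto
    ultimately show ?case
      unfolding sum.lessThan_Suc by (intro order_trans[OF add_right_mono[OF Suc.IH]])
  qed simp
  also have "\<dots> \<le> variation \<A> \<mu> E" using assms(2) by (intro variation_mono) auto
  finally show ?thesis .
qed

section \<open>Bounds for the integral\<close>

text \<open>
  A countable partition is not one of the finite families that define the variation, but its finite
  subfamilies are, and they bound the infinite sum. If the right-hand side is infinite there is
  nothing to show, so the bound is stated in \<open>[0,\<infinity>]\<close>.
\<close>

lemma norm_RL_sum_le_variation:
  assumes "countable_partition \<A> A P" "RL_admissible m f P" "tags t P"
    and m: "\<And>B. B \<in> \<A> \<Longrightarrow> 0 \<le> m B" and M: "\<And>x. x \<in> A \<Longrightarrow> norm (f x) \<le> M"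
  shows "ennreal (norm (RL_sum m f P t)) \<le> ennreal M * variation \<A> m A"
proof (cases "ennreal M * variation \<A> m A" rule: ennreal_cases)
  case (real v)
  have P: "P \<subseteq> \<A>" "\<Union>P = A" "disjoint P"
    using assms(1) by (auto simp: countable_partition_def partition_on_def)
  have summable: "(\<lambda>B. norm (m B *\<^sub>R f (t B))) summable_on P"
    using assms(2,3) by (simp add: RL_admissible_def)
  have "(\<Sum>B\<in>F. norm (m B *\<^sub>R f (t B))) \<le> v" if F: "finite F" "F \<subseteq> P" for F
  proof -
    have "ennreal (norm (m B *\<^sub>R f (t B))) \<le> ennreal M * ennreal (norm (m B))" if "B \<in> F" for B
    proof -
      have "t B \<in> A" using that F P assms(3) by (auto simp: tags_def)
      then have b: "norm (f (t B)) \<le> M" by (rule M)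
      then have "norm (m B *\<^sub>R f (t B)) \<le> M * norm (m B)"
        by (simp add: mult.commute[of M] mult_left_mono)
      then show ?thesis
        using order_trans[OF norm_ge_zero b] by (simp flip: ennreal_mult add: ennreal_leI)
    qed
    then have "(\<Sum>B\<in>F. ennreal (norm (m B *\<^sub>R f (t B)))) \<le> ennreal M * (\<Sum>B\<in>F. ennreal (norm (m B)))"
      unfolding sum_distrib_left by (rule sum_mono)
    also have "(\<Sum>B\<in>F. ennreal (norm (m B))) \<le> variation \<A> m A"
    proof (rule sum_le_variation[OF F(1), where B = "\<lambda>B. B"])
      show "disjoint_family_on (\<lambda>B. B) F"
        using P(3) F(2) unfolding disjoint_family_on_def disjoint_def by blast
    qed (use F P in auto)
    finally have "ennreal (\<Sum>B\<in>F. norm (m B *\<^sub>R f (t B))) \<le> ennreal v"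
      by (simp add: real mult_left_mono)
    then show ?thesis using real by simp
  qed
  then have "(\<Sum>\<^sub>\<infinity>B\<in>P. norm (m B *\<^sub>R f (t B))) \<le> v"
    by (rule infsum_le_finite_sums[OF summable])
  then have "norm (RL_sum m f P t) \<le> v"
    unfolding RL_sum_def using norm_infsum_bound[OF summable] by linarith
  then show ?thesis using real by (simp add: ennreal_leI)
qed simp

lemma norm_RL_integral_le_variation:
  assumes "sigma_algebra T \<A>" "RL_integrable \<A> m f A"
    and m: "\<And>B. B \<in> \<A> \<Longrightarrow> 0 \<le> m B" and M: "\<And>x. x \<in> A \<Longrightarrow> norm (f x) \<le> M"
  shows "ennreal (norm (RL_integral \<A> m f A)) \<le> ennreal M * variation \<A> m A"
proof (rule ennreal_le_epsilon)
  fix \<epsilon> :: real assume \<epsilon>: "0 < \<epsilon>"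
  obtain P t where P: "countable_partition \<A> A P" "RL_admissible m f P" "tags t P"
    "norm (RL_sum m f P t - RL_integral \<A> m f A) < \<epsilon>"
    using has_RL_integral_approx[OF assms(1) has_RL_integral_RL_integral[OF assms(1,2)] \<epsilon>] .
  have "norm (RL_integral \<A> m f A) \<le> norm (RL_sum m f P t) + \<epsilon>"
    using P(4) norm_triangle_ineq3[of "RL_sum m f P t" "RL_integral \<A> m f A"] by linarith
  then have "ennreal (norm (RL_integral \<A> m f A)) \<le> ennreal (norm (RL_sum m f P t)) + ennreal \<epsilon>"
    using \<epsilon> by (simp flip: ennreal_plus add: ennreal_leI)
  also have "\<dots> \<le> ennreal M * variation \<A> m A + ennreal \<epsilon>"
    using norm_RL_sum_le_variation[OF P(1-3) m M] by (simp add: add_right_mono)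
  finally show "ennreal (norm (RL_integral \<A> m f A)) \<le> ennreal M * variation \<A> m A + ennreal \<epsilon>" .
qed

text \<open>
  The bound is applied to each member of a disjoint family; the variations of \<open>m\<close> on the members
  add up to at most the variation on \<open>T\<close>.
\<close>

lemma variation_RL_integral_le:
  assumes "sigma_algebra T \<A>" "RL_integrable \<A> m f T"
    and m: "\<And>B. B \<in> \<A> \<Longrightarrow> 0 \<le> m B" and M: "\<And>x. x \<in> T \<Longrightarrow> norm (f x) \<le> M"
  shows "variation \<A> (RL_integral \<A> m f) T \<le> ennreal M * variation \<A> m T"
proof (rule variation_least)
  fix n :: nat and B
  assume BT: "\<forall>i<n. B i \<in> \<A> \<and> B i \<subseteq> T" and disj: "disjoint_family_on B {..<n}"
  have B: "\<And>i. i < n \<Longrightarrow> B i \<in> \<A>" "\<And>i. i < n \<Longrightarrow> B i \<subseteq> T"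
    using BT by blast+
  interpret sigma_algebra T \<A> by fact
  have "ennreal (norm (RL_integral \<A> m f (B i))) \<le> ennreal M * variation \<A> m (B i)" if "i < n" for i
    using that B M RL_integrable_subset[OF assms(1,2) _ top]
    by (intro norm_RL_integral_le_variation[OF assms(1) _ m]) auto
  then have "(\<Sum>i<n. ennreal (norm (RL_integral \<A> m f (B i)))) \<le> ennreal M * (\<Sum>i<n. variation \<A> m (B i))"
    unfolding sum_distrib_left by (intro sum_mono) auto
  also have "\<dots> \<le> ennreal M * variation \<A> m T"
    by (intro mult_left_mono sum_variation_le disj B) auto
  finally show "(\<Sum>i<n. ennreal (norm (RL_integral \<A> m f (B i)))) \<le> ennreal M * variation \<A> m T" .
qed

text \<open>
  A tagged partition of \<open>A\<close> that is fine for both integrals is extended by one of \<open>B - A\<close>, whose sum is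
  nonnegative; both integrals are then approximated by sums that share the terms over \<open>A\<close>.
\<close>

lemma RL_integral_mono_set:
  fixes f :: "'a \<Rightarrow> real"
  assumes sa: "sigma_algebra T \<A>" and "RL_integrable \<A> m f B" "A \<in> \<A>" "B \<in> \<A>" "A \<subseteq> B"
    and m: "\<And>C. C \<in> \<A> \<Longrightarrow> 0 \<le> m C" and f: "\<And>x. x \<in> B \<Longrightarrow> 0 \<le> f x"
  shows "RL_integral \<A> m f A \<le> RL_integral \<A> m f B"
proof (rule field_le_epsilon)
  fix \<epsilon> :: real assume "0 < \<epsilon>"
  then have \<epsilon>: "\<epsilon> / 2 > 0" by simp
  let ?a = "RL_integral \<A> m f A" and ?b = "RL_integral \<A> m f B"
  have a: "has_RL_integral \<A> m f A ?a"
    by (rule has_RL_integral_RL_integral[OF sa RL_integrable_subset[OF assms(1-5)]])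
  have b: "has_RL_integral \<A> m f B ?b"
    by (rule has_RL_integral_RL_integral[OF sa assms(2)])
  obtain Pa where Pa: "countable_partition \<A> A Pa"
    "\<And>R. countable_partition \<A> A R \<Longrightarrow> finer R Pa \<Longrightarrow> RL_admissible m f R"
    "\<And>R t. countable_partition \<A> A R \<Longrightarrow> finer R Pa \<Longrightarrow> tags t R \<Longrightarrow> norm (RL_sum m f R t - ?a) < \<epsilon> / 2"
    using a \<epsilon> unfolding has_RL_integral_iff by meson
  obtain Pb where Pb: "countable_partition \<A> B Pb"
    "\<And>R. countable_partition \<A> B R \<Longrightarrow> finer R Pb \<Longrightarrow> RL_admissible m f R"
    "\<And>R t. countable_partition \<A> B R \<Longrightarrow> finer R Pb \<Longrightarrow> tags t R \<Longrightarrow> norm (RL_sum m f R t - ?b) < \<epsilon> / 2"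
    using b \<epsilon> unfolding has_RL_integral_iff by meson
  \<comment> \<open>\<open>P\<close> is finer than \<open>Pa\<close> to approximate the integral over \<open>A\<close>, and finer than \<open>Pb\<close> to be part of a
    partition of \<open>B\<close> that approximates the integral over \<open>B\<close>.\<close>
  obtain P where P: "countable_partition \<A> A P" "finer P Pb" "finer P Pa"
    using common_refinement[OF sa Pb(1) Pa(1) assms(5)] .
  obtain Q where Q: "countable_partition \<A> (B - A) Q" "countable_partition \<A> B (P \<union> Q)"
    "finer (P \<union> Q) Pb" "P \<inter> Q = {}"
    by (rule partition_extension[OF sa Pb(1) assms(3-5)]) (use P(1,2) in blast)
  obtain t where t: "tags t P" using tags_exist[OF P(1)] .
  obtain s where s: "tags s Q" using tags_exist[OF Q(1)] .
  have adm: "RL_admissible m f P" "RL_admissible m f Q"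
    using Pa(2)[OF P(1,3)] RL_admissible_mono[of m f Q P, OF _ P(1)] Pb(2)[OF Q(2,3)]
    by (simp_all only: Un_commute[of Q P])
  note u = RL_sum_Un[OF adm Q(4) t s]
  have "0 \<le> RL_sum m f Q s"
  proof -
    have "0 \<le> m C *\<^sub>R f (s C)" if "C \<in> Q" for C
    proof -
      have "C \<in> \<A>" "s C \<in> B"
        using that Q(1) s unfolding countable_partition_def partition_on_def tags_def by blast+
      then show ?thesis using m f by simp
    qed
    then show ?thesis unfolding RL_sum_def by (rule infsum_nonneg)
  qed
  moreover have "norm (RL_sum m f P t - ?a) < \<epsilon> / 2" using Pa(3)[OF P(1,3) t] .
  moreover have "norm (RL_sum m f P t + RL_sum m f Q s - ?b) < \<epsilon> / 2"
    using Pb(3)[OF Q(2,3) u(1)] unfolding u(2) .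
  ultimately show "?a \<le> ?b + \<epsilon>" unfolding real_norm_def by linarith
qed

section \<open>Absolute continuity and monotonicity\<close>

lemma RL_integral_abs_continuous:
  assumes "sigma_algebra T \<A>" "RL_integrable \<A> m f T" "bounded (f ` T)"
    and m: "\<And>B. B \<in> \<A> \<Longrightarrow> 0 \<le> m B" and "\<epsilon> > 0"
  shows "\<exists>\<delta>>0. \<forall>A\<in>\<A>. variation \<A> m A < ennreal \<delta> \<longrightarrow> norm (RL_integral \<A> m f A) < \<epsilon>"
proof -
  interpret sigma_algebra T \<A> by fact
  obtain M where M: "M > 0" "\<And>x. x \<in> T \<Longrightarrow> norm (f x) \<le> M"
    using assms(3) unfolding bounded_pos by auto
  have "norm (RL_integral \<A> m f A) < \<epsilon>" if A: "A \<in> \<A>" "variation \<A> m A < ennreal (\<epsilon> / M)" for A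
  proof -
    have "A \<subseteq> T" using A(1) sets_into_space by blast
    then have "ennreal (norm (RL_integral \<A> m f A)) \<le> ennreal M * variation \<A> m A"
      using M(2) RL_integrable_subset[OF assms(1,2) A(1) top]
      by (intro norm_RL_integral_le_variation[OF assms(1) _ m]) auto
    also have "\<dots> < ennreal M * ennreal (\<epsilon> / M)"
      using A(2) M(1) by (intro ennreal_mult_strict_left_mono) (auto simp: less_top)
    also have "\<dots> = ennreal \<epsilon>" using M(1) assms(5) by (simp flip: ennreal_mult)
    finally show ?thesis using assms(5) by (simp add: ennreal_less_iff)
  qed
  then show ?thesis using M(1) assms(5) by (intro exI[of _ "\<epsilon> / M"]) auto
qed

lemma tendsto_zero_of_abs_continuous:
  fixes \<mu> :: "'a set \<Rightarrow> ennreal" and \<nu> :: "'a set \<Rightarrow> 'b::real_normed_vector"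
  assumes "\<And>\<epsilon>. \<epsilon> > 0 \<Longrightarrow> \<exists>\<delta>>0. \<forall>A\<in>\<A>. \<mu> A < ennreal \<delta> \<longrightarrow> norm (\<nu> A) < \<epsilon>"
    and "range A \<subseteq> \<A>" "(\<lambda>n. \<mu> (A n)) \<longlonglongrightarrow> 0"
  shows "(\<lambda>n. \<nu> (A n)) \<longlonglongrightarrow> 0"
proof (rule tendstoI)
  fix \<epsilon> :: real assume "\<epsilon> > 0"
  then obtain \<delta> where \<delta>: "\<delta> > 0" "\<And>B. B \<in> \<A> \<Longrightarrow> \<mu> B < ennreal \<delta> \<Longrightarrow> norm (\<nu> B) < \<epsilon>"
    using assms(1) by meson
  have "eventually (\<lambda>n. \<mu> (A n) < ennreal \<delta>) sequentially"
    using assms(3) \<delta>(1) by (intro order_tendstoD(2)) auto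
  then show "eventually (\<lambda>n. dist (\<nu> (A n)) 0 < \<epsilon>) sequentially"
    by eventually_elim (use \<delta>(2) assms(2) in auto)
qed

theorem theorem3p12:
  fixes T :: "'a set" and \<A> :: "'a set set" and m :: "'a set \<Rightarrow> real"
  assumes "infinite T"
    and "sigma_algebra T \<A>"
    and "m {} = 0"
    and "\<And>A. A \<in> \<A> \<Longrightarrow> 0 \<le> m A"
  shows
    "(\<forall>f :: 'a \<Rightarrow> 'b::banach.
        RL_integrable \<A> m f T \<and> bounded (f ` T) \<and> variation \<A> m T < \<infinity> \<longrightarrow>
          (\<forall>\<epsilon>>0. \<exists>\<delta>>0. \<forall>A\<in>\<A>. variation \<A> m A < ennreal \<delta> \<longrightarrow>
              norm (RL_integral \<A> m f A) < \<epsilon>) \<and>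
          variation \<A> (RL_integral \<A> m f) T < \<infinity> \<and>
          (order_continuous \<A> (variation \<A> m) \<longrightarrow> order_continuous \<A> (RL_integral \<A> m f)) \<and>
          (exhaustive \<A> (variation \<A> m) \<longrightarrow> exhaustive \<A> (RL_integral \<A> m f))) \<and>
     (\<forall>f :: 'a \<Rightarrow> real.
        RL_integrable \<A> m f T \<and> (\<forall>t\<in>T. 0 \<le> f t) \<and> mono_on \<A> m \<longrightarrow>
          mono_on \<A> (RL_integral \<A> m f))"
proof (intro conjI allI impI; (elim conjE)?)
  fix f :: "'a \<Rightarrow> 'b"
  assume f: "RL_integrable \<A> m f T" "bounded (f ` T)" "variation \<A> m T < \<infinity>"
  show ac: "\<exists>\<delta>>0. \<forall>A\<in>\<A>. variation \<A> m A < ennreal \<delta> \<longrightarrow> norm (RL_integral \<A> m f A) < \<epsilon>"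
    if "\<epsilon> > 0" for \<epsilon>
    by (rule RL_integral_abs_continuous[OF assms(2) f(1,2) assms(4) that])
  obtain M where M: "\<And>x. x \<in> T \<Longrightarrow> norm (f x) \<le> M"
    using f(2) unfolding bounded_pos by auto
  have "variation \<A> (RL_integral \<A> m f) T \<le> ennreal M * variation \<A> m T"
    by (rule variation_RL_integral_le[OF assms(2) f(1) assms(4) M])
  also have "\<dots> < \<infinity>" using f(3) by (simp add: ennreal_mult_less_top)
  finally show "variation \<A> (RL_integral \<A> m f) T < \<infinity>" .
  show "order_continuous \<A> (RL_integral \<A> m f)" if "order_continuous \<A> (variation \<A> m)"
    using that tendsto_zero_of_abs_continuous[OF ac] unfolding order_continuous_def by blast
  show "exhaustive \<A> (RL_integral \<A> m f)" if "exhaustive \<A> (variation \<A> m)"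
    using that tendsto_zero_of_abs_continuous[OF ac] unfolding exhaustive_def by blast
next
  fix f :: "'a \<Rightarrow> real"
  assume f: "RL_integrable \<A> m f T" "\<forall>t\<in>T. 0 \<le> f t" "mono_on \<A> m"
  interpret sigma_algebra T \<A> by fact
  show "mono_on \<A> (RL_integral \<A> m f)"
  proof (rule mono_onI)
    fix A B assume AB: "A \<in> \<A>" "B \<in> \<A>" "A \<subseteq> B"
    have "B \<subseteq> T" using AB(2) sets_into_space by blast
    then show "RL_integral \<A> m f A \<le> RL_integral \<A> m f B"
      using f(2) RL_integrable_subset[OF assms(2) f(1) AB(2) top]
      by (intro RL_integral_mono_set[OF assms(2) _ AB assms(4)]) auto
  qed
qed

end
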